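(* For each integer $n\ge 0$, $$5\sigma_{3}(n)-\widetilde{\sigma}_{3}(n)=48\sum_{\substack{i,j\ge 0\\ i+j=n}}\widehat{\sigma}(i)\,\widehat{\sigma}(j),$$ $$7\sigma_{5}(n)+\widetilde{\sigma}_{5}(n)=1536\sum_{\substack{i,j,k\ge 0\\ i+j+k=n}}\widehat{\sigma}(i)\,\widehat{\sigma}(j)\,\widehat{\sigma}(k),$$ where $\sigma_{3}(0)=\tfrac1{240}$, $\widetilde{\sigma}_{3}(0)=-\tfrac1{16}$, $\widehat{\sigma}(0)=\tfrac1{24}$, $\sigma_{5}(0)=-\tfrac1{504}$ and $\widetilde{\sigma}_{5}(0)=\tfrac18$.
   Context: For integers $n\ge1$, $\sigma_{s}(n)=\sum_{d\mid n}d^{s}$, $\widetilde{\sigma}_{s}(n)=\sum_{d\mid n}(-1)^{d-1}d^{s}$ and $\widehat{\sigma}(n)=\widehat{\sigma}_{1}(n)=\sum_{d\mid n}(-1)^{n/d-1}d$. Values at $n=0$ are assigned as in the claim. *)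

theory Defs
  imports Complex_Main
begin

definition sigma :: "nat \<Rightarrow> nat \<Rightarrow> real" where
  "sigma s n = (\<Sum>d | d dvd n. real d ^ s)"

definition sigma_tilde :: "nat \<Rightarrow> nat \<Rightarrow> real" where
  "sigma_tilde s n = (\<Sum>d | d dvd n. (-1) ^ (d - 1) * real d ^ s)"

definition sigma_hat :: "nat \<Rightarrow> real" where
  "sigma_hat n = (\<Sum>d | d dvd n. (-1) ^ (n div d - 1) * real d)"

text \<open>
  The divisor sums above are meaningful only for positive \<open>n\<close> (every number divides 0, so
  at 0 they are sums over an infinite set). The functions below agree with them for positive
  \<open>n\<close> and have the conventional values at 0.
\<close>

definition sigma3 :: "nat \<Rightarrow> real" where
  "sigma3 = (sigma 3)(0 := 1 / 240)"

definition sigma5 :: "nat \<Rightarrow> real" where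
  "sigma5 = (sigma 5)(0 := - 1 / 504)"

definition sigma_tilde3 :: "nat \<Rightarrow> real" where
  "sigma_tilde3 = (sigma_tilde 3)(0 := - 1 / 16)"

definition sigma_tilde5 :: "nat \<Rightarrow> real" where
  "sigma_tilde5 = (sigma_tilde 5)(0 := 1 / 8)"

definition sigma_hat0 :: "nat \<Rightarrow> real" where
  "sigma_hat0 = sigma_hat(0 := 1 / 24)"

end

theory Submission
  imports Defs "HOL-Computational_Algebra.Formal_Power_Series"
begin

text \<open>
  Let \<open>e\<^sub>k\<close> and \<open>t\<^sub>k\<close> be the power series with coefficients \<open>sigma k\<close> and \<open>sigma_tilde k\<close>
  (without constant term) and let \<open>D = X d/dX\<close>. Liouville's identity, which evaluates
  \<open>\<Sum> f(a + b) - f(a - b)\<close> over \<open>ax + by = n\<close> for even \<open>f\<close>, applied to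
  \<open>f(x) = (\<plusminus>1)\<^sup>x x\<^sup>2\<close> and \<open>f(x) = (\<plusminus>1)\<^sup>x x\<^sup>4\<close>, expresses
  \<open>e\<^sub>1\<^sup>2\<close>, \<open>t\<^sub>1\<^sup>2\<close>, \<open>e\<^sub>1e\<^sub>3\<close>, \<open>t\<^sub>1t\<^sub>3\<close>
  linearly in the \<open>e\<^sub>k\<close>, \<open>t\<^sub>k\<close> and their images under \<open>D\<close>. Substituting \<open>X\<^sup>2\<close> for \<open>X\<close>
  turns \<open>e\<^sub>k\<close> into a multiple of \<open>e\<^sub>k - t\<^sub>k\<close> and gives two more relations. The series of
  \<open>sigma_hat\<close> is \<open>u/2\<close> with \<open>u = e\<^sub>1 + t\<^sub>1\<close>; the relations determine \<open>u\<^sup>2\<close>, and applying \<open>D\<close> to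
  that first identity supplies the one missing relation that determines \<open>u\<^sup>3\<close>.
\<close>

unbundle fps_syntax

section \<open>Liouville's identity for solutions of a x + b y = n\<close>

definition quads :: "nat \<Rightarrow> (nat \<times> nat \<times> nat \<times> nat) set" where
  "quads n = {(a, b, x, y). 0 < a \<and> 0 < b \<and> 0 < x \<and> 0 < y \<and> a * x + b * y = n}"

lemma finite_quads [simp]: "finite (quads n)"
proof (rule finite_subset)
  show "quads n \<subseteq> {..n} \<times> {..n} \<times> {..n} \<times> {..n}"
  proof (clarsimp simp: quads_def)
    fix a b x y :: nat
    assume "0 < a" "0 < b" "0 < x" "0 < y"
    then have "a \<le> a * x" "x \<le> a * x" "b \<le> b * y" "y \<le> b * y" by auto
    then show "a \<le> a * x + b * y \<and> b \<le> a * x + b * y \<and> x \<le> a * x + b * y \<and> y \<le> a * x + b * y"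
      by linarith
  qed
qed simp

lemma sum_quads_split:
  fixes h :: "nat \<times> nat \<times> nat \<times> nat \<Rightarrow> real" and u v :: "nat \<Rightarrow> nat \<Rightarrow> nat \<Rightarrow> nat \<Rightarrow> nat"
  shows "sum h (quads n) = sum h {(a, b, x, y) \<in> quads n. u a b x y < v a b x y}
           + sum h {(a, b, x, y) \<in> quads n. u a b x y = v a b x y}
           + sum h {(a, b, x, y) \<in> quads n. v a b x y < u a b x y}"
    (is "_ = sum h ?L + sum h ?E + sum h ?G")
proof -
  have fin: "finite ?L" "finite ?E" "finite ?G"
    by (rule finite_subset[OF _ finite_quads[of n]]; auto)+
  have "quads n = (?L \<union> ?E) \<union> ?G"
    by auto
  moreover have "(?L \<union> ?E) \<inter> ?G = {}" "?L \<inter> ?E = {}"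
    by auto
  ultimately show ?thesis
    using fin by (metis (no_types, lifting) sum.union_disjoint finite_UnI)
qed

text \<open>Since a x + b y = (a - b) x + b (x + y), the subtraction a - b can be traded for the
  addition x + y. The condition b < a then becomes x < y.\<close>

lemma sum_quads_diff:
  fixes f :: "int \<Rightarrow> real"
  shows "(\<Sum>(a, b, x, y) \<in> {(a, b, x, y) \<in> quads n. b < a}. f (int a - int b))
       = (\<Sum>(a, b, x, y) \<in> {(a, b, x, y) \<in> quads n. x < y}. f (int a))"
  by (rule sum.reindex_bij_witness[where
        i = "\<lambda>(a, b, x, y). (a + b, b, x, y - x)" and j = "\<lambda>(a, b, x, y). (a - b, b, x, y + x)"])
     (auto simp: quads_def algebra_simps dest!: less_imp_Suc_add)

lemma sum_quads_swap:
  fixes h :: "nat \<Rightarrow> nat \<Rightarrow> nat \<Rightarrow> nat \<Rightarrow> real"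
  shows "(\<Sum>(a, b, x, y) \<in> {(a, b, x, y) \<in> quads n. P a b x y}. h a b x y)
       = (\<Sum>(a, b, x, y) \<in> {(a, b, x, y) \<in> quads n. P b a y x}. h b a y x)"
  by (rule sum.reindex_bij_witness[where
        i = "\<lambda>(a, b, x, y). (b, a, y, x)" and j = "\<lambda>(a, b, x, y). (b, a, y, x)"])
     (auto simp: quads_def)

text \<open>Here a x + b y = (a + b) y + a (x - y): a + b becomes the new first entry, and the old
  a, which is smaller, the second.\<close>

lemma sum_quads_add:
  fixes f :: "int \<Rightarrow> real"
  shows "(\<Sum>(a, b, x, y) \<in> {(a, b, x, y) \<in> quads n. y < x}. f (int a + int b))
       = (\<Sum>(a, b, x, y) \<in> {(a, b, x, y) \<in> quads n. b < a}. f (int a))"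
  by (rule sum.reindex_bij_witness[where
        i = "\<lambda>(a, b, x, y). (b, a - b, x + y, x)" and j = "\<lambda>(a, b, x, y). (a + b, a, y, x - y)"])
     (auto simp: quads_def algebra_simps dest!: less_imp_Suc_add)

text \<open>This time a itself is kept: a x + b y = a (x - y) + (a + b) y.\<close>

lemma sum_quads_shear:
  fixes f :: "int \<Rightarrow> real"
  shows "(\<Sum>(a, b, x, y) \<in> {(a, b, x, y) \<in> quads n. y < x}. f (int a))
       = (\<Sum>(a, b, x, y) \<in> {(a, b, x, y) \<in> quads n. a < b}. f (int a))"
  by (rule sum.reindex_bij_witness[where
        i = "\<lambda>(a, b, x, y). (a, b - a, x + y, y)" and j = "\<lambda>(a, b, x, y). (a, a + b, x - y, y)"])
     (auto simp: quads_def algebra_simps dest!: less_imp_Suc_add)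

text \<open>For a = b = d the equation reads d (x + y) = n, so d divides n and x takes n/d - 1
  values.\<close>

lemma sum_quads_diag_ab:
  fixes f :: "int \<Rightarrow> real"
  assumes "n > 0"
  shows "(\<Sum>(a, b, x, y) \<in> {(a, b, x, y) \<in> quads n. a = b}. f (int a))
       = (\<Sum>d | d dvd n. (real (n div d) - 1) * f (int d))"
proof -
  have "(\<Sum>(a, b, x, y) \<in> {(a, b, x, y) \<in> quads n. a = b}. f (int a))
      = (\<Sum>(d, x) \<in> (SIGMA d:{d. d dvd n}. {0<..<n div d}). f (int d))"
    by (rule sum.reindex_bij_witness[where
          i = "\<lambda>(d, x). (d, d, x, n div d - x)" and j = "\<lambda>(a, b, x, y). (a, x)"])
       (use assms in \<open>auto simp: quads_def simp flip: distrib_left add_mult_distrib2\<close>)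
  also have "\<dots> = (\<Sum>d | d dvd n. \<Sum>x\<in>{0<..<n div d}. f (int d))"
    using assms by (subst sum.Sigma) (auto simp: finite_divisors_nat)
  also have "\<dots> = (\<Sum>d | d dvd n. (real (n div d) - 1) * f (int d))"
    using assms by (intro sum.cong refl) (auto simp: of_nat_diff Suc_leI div_greater_zero_iff dvd_imp_le)
  finally show ?thesis .
qed

text \<open>For x = y the equation reads (a + b) x = n, so d = a + b divides n and a = l runs over 0
  < l < d. The function \<open>h\<close> takes both a and a + b because the lemma is used for f(a +
  b) as well as for f(a).\<close>

lemma sum_quads_diag_xy:
  fixes h :: "nat \<Rightarrow> nat \<Rightarrow> real"
  assumes "n > 0"
  shows "(\<Sum>(a, b, x, y) \<in> {(a, b, x, y) \<in> quads n. x = y}. h a (a + b))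
       = (\<Sum>d | d dvd n. \<Sum>l\<in>{0<..<d}. h l d)"
proof -
  have "(\<Sum>(a, b, x, y) \<in> {(a, b, x, y) \<in> quads n. x = y}. h a (a + b))
      = (\<Sum>(d, l) \<in> (SIGMA d:{d. d dvd n}. {0<..<d}). h l d)"
    by (rule sum.reindex_bij_witness[where
          i = "\<lambda>(d, l). (l, d - l, n div d, n div d)" and j = "\<lambda>(a, b, x, y). (a + b, a)"])
       (use assms in \<open>auto simp: quads_def simp flip: distrib_right add_mult_distrib\<close>)
  also have "\<dots> = (\<Sum>d | d dvd n. \<Sum>l\<in>{0<..<d}. h l d)"
    using assms by (subst sum.Sigma) (auto simp: finite_divisors_nat)
  finally show ?thesis .
qed

text \<open>The bijections above reduce everything to sums \<open>S P\<close> of f(a) over parts of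
  \<open>quads n\<close>. Up to a diagonal, f(a + b) gives twice the part b < a, and by evenness f(a
  - b) gives twice the part x < y. To compare these two parts, the whole sum of f(a) is cut once by
  x against y and once by a against b; the parts y < x and a < b agree and cancel, so only diagonals
  remain, and these are divisor sums.\<close>

lemma liouville_identity:
  fixes f :: "int \<Rightarrow> real"
  assumes "n > 0" and even: "\<And>x. f (- x) = f x" and zero: "f 0 = 0"
  shows "(\<Sum>(a, b, x, y) \<in> quads n. f (int a + int b) - f (int a - int b))
       = (\<Sum>d | d dvd n. (real d - 1) * f (int d) + 2 * (\<Sum>l<d. f (int l))
            - 2 * (real (n div d) - 1) * f (int d))"
proof -
  define S where "S P = (\<Sum>(a, b, x, y) \<in> {(a, b, x, y) \<in> quads n. P a b x y}. f (int a))"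
    for P :: "nat \<Rightarrow> nat \<Rightarrow> nat \<Rightarrow> nat \<Rightarrow> bool"
  have pos: "d > 0" if "d dvd n" for d
    using that \<open>n > 0\<close> by (auto intro: Nat.gr0I)
  have inner: "(\<Sum>l\<in>{0<..<d}. f (int l)) = (\<Sum>l<d. f (int l))" for d
    by (rule sum.mono_neutral_left) (auto simp: zero)
  have "(\<Sum>(a, b, x, y) \<in> {(a, b, x, y) \<in> quads n. x < y}. f (int a + int b))
      = (\<Sum>(a, b, x, y) \<in> {(a, b, x, y) \<in> quads n. y < x}. f (int a + int b))"
    by (subst sum_quads_swap) (simp only: add.commute)
  then have "(\<Sum>(a, b, x, y) \<in> quads n. f (int a + int b))
      = 2 * S (\<lambda>a b x y. b < a) + (\<Sum>d | d dvd n. \<Sum>l\<in>{0<..<d}. f (int d))"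
    using sum_quads_split[of "\<lambda>(a, b, x, y). f (int a + int b)" n "\<lambda>a b x y. x" "\<lambda>a b x y. y"]
      sum_quads_diag_xy[OF \<open>n > 0\<close>, of "\<lambda>l d. f (int d)"] sum_quads_add[of f n]
    by (simp add: S_def)
  also have "(\<Sum>d | d dvd n. \<Sum>l\<in>{0<..<d}. f (int d)) = (\<Sum>d | d dvd n. (real d - 1) * f (int d))"
    by (intro sum.cong refl) (auto simp: of_nat_diff Suc_leI dest!: pos)
  finally have add: "(\<Sum>(a, b, x, y) \<in> quads n. f (int a + int b))
      = 2 * S (\<lambda>a b x y. b < a) + (\<Sum>d | d dvd n. (real d - 1) * f (int d))" .
  have "(\<Sum>(a, b, x, y) \<in> {(a, b, x, y) \<in> quads n. a = b}. f (int a - int b)) = 0"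
    by (rule sum.neutral) (auto simp: zero)
  moreover have "(\<Sum>(a, b, x, y) \<in> {(a, b, x, y) \<in> quads n. a < b}. f (int a - int b))
      = (\<Sum>(a, b, x, y) \<in> {(a, b, x, y) \<in> quads n. b < a}. f (int a - int b))"
    by (subst sum_quads_swap, subst even[symmetric]) (simp only: minus_diff_eq)
  ultimately have diff: "(\<Sum>(a, b, x, y) \<in> quads n. f (int a - int b)) = 2 * S (\<lambda>a b x y. x < y)"
    using sum_quads_split[of "\<lambda>(a, b, x, y). f (int a - int b)" n "\<lambda>a b x y. a" "\<lambda>a b x y. b"]
      sum_quads_diff[of f n]
    by (simp add: S_def)
  have "S (\<lambda>a b x y. x < y) + S (\<lambda>a b x y. x = y) + S (\<lambda>a b x y. y < x)
      = S (\<lambda>a b x y. a < b) + S (\<lambda>a b x y. a = b) + S (\<lambda>a b x y. b < a)"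
    using sum_quads_split[of "\<lambda>(a, b, x, y). f (int a)" n "\<lambda>a b x y. x" "\<lambda>a b x y. y"]
      sum_quads_split[of "\<lambda>(a, b, x, y). f (int a)" n "\<lambda>a b x y. a" "\<lambda>a b x y. b"]
    by (simp add: S_def)
  moreover have "S (\<lambda>a b x y. y < x) = S (\<lambda>a b x y. a < b)"
    using sum_quads_shear by (simp add: S_def)
  moreover have "S (\<lambda>a b x y. a = b) = (\<Sum>d | d dvd n. (real (n div d) - 1) * f (int d))"
    using sum_quads_diag_ab[OF \<open>n > 0\<close>] by (simp add: S_def)
  moreover have "S (\<lambda>a b x y. x = y) = (\<Sum>d | d dvd n. \<Sum>l<d. f (int l))"
    using sum_quads_diag_xy[OF \<open>n > 0\<close>, of "\<lambda>l d. f (int l)"] by (simp add: S_def inner)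
  ultimately have "2 * S (\<lambda>a b x y. b < a) - 2 * S (\<lambda>a b x y. x < y)
      = (\<Sum>d | d dvd n. 2 * (\<Sum>l<d. f (int l)) - 2 * (real (n div d) - 1) * f (int d))"
    by (simp add: sum_subtractf sum.distrib sum_distrib_left[symmetric] algebra_simps)
  then show ?thesis
    using add diff
    by (simp add: sum_subtractf sum.distrib case_prod_unfold)
qed

text \<open>The function s^|x| x^(k+1) is even since k is odd, and a + b and a - b have the same
  parity, so both terms carry the sign s^(a+b). On the right, (n/d) d^(k+1) = n d^k is the only part
  depending on n; the rest, where d - 1 and +2 combine to d + 1, is the polynomial expression
  abbreviated by \<open>G d\<close>.\<close>

lemma liouville_power:
  fixes s :: real
  assumes "n > 0" "s = 1 \<or> s = -1" "odd k"
    and G: "\<And>d. s ^ d * (real d + 1) * real d ^ (k + 1) + 2 * (\<Sum>l<d. s ^ l * real l ^ (k + 1)) = G d"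
  shows "(\<Sum>(a, b, x, y) \<in> quads n.
            s ^ (a + b) * ((real a + real b) ^ (k + 1) - (real a - real b) ^ (k + 1)))
       = (\<Sum>d | d dvd n. G d - 2 * (real n * (s ^ d * real d ^ k)))"
proof -
  define f where "f x = s ^ nat \<bar>x\<bar> * of_int x ^ (k + 1)" for x
  have f_nat: "f (int d) = s ^ d * real d ^ (k + 1)" for d
    by (simp add: f_def)
  have parity: "s ^ nat \<bar>int a - int b\<bar> = s ^ (a + b)" for a b
    using assms(2) by (auto simp: minus_one_power_iff even_nat_iff)
  have "(\<Sum>(a, b, x, y) \<in> quads n.
            s ^ (a + b) * ((real a + real b) ^ (k + 1) - (real a - real b) ^ (k + 1)))
      = (\<Sum>(a, b, x, y) \<in> quads n. f (int a + int b) - f (int a - int b))"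
    unfolding f_def parity
    by (intro sum.cong refl) (auto simp: right_diff_distrib nat_add_distrib simp flip: of_nat_add)
  also have "\<dots> = (\<Sum>d | d dvd n. (real d - 1) * f (int d) + 2 * (\<Sum>l<d. f (int l))
            - 2 * (real (n div d) - 1) * f (int d))"
    using assms by (intro liouville_identity) (auto simp: f_def)
  also have "\<dots> = (\<Sum>d | d dvd n. G d - 2 * (real n * (s ^ d * real d ^ k)))"
  proof (intro sum.cong refl)
    fix d assume "d \<in> {d. d dvd n}"
    then have "real n * real d ^ k = real (n div d) * real d ^ (k + 1)"
      by (auto simp: mult.assoc[symmetric] simp flip: of_nat_mult)
    then have "real n * (s ^ d * real d ^ k) = real (n div d) * f (int d)"
      by (simp add: f_nat)
    then show "(real d - 1) * f (int d) + 2 * (\<Sum>l<d. f (int l)) - 2 * (real (n div d) - 1) * f (int d)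
        = G d - 2 * (real n * (s ^ d * real d ^ k))"
      unfolding G[symmetric] by (simp add: f_nat algebra_simps)
  qed
  finally show ?thesis .
qed

section \<open>Generating series of divisor sums\<close>

definition divisor_fps :: "(nat \<Rightarrow> real) \<Rightarrow> real fps" where
  "divisor_fps g = Abs_fps (\<lambda>n. if n = 0 then 0 else \<Sum>d | d dvd n. g d)"

lemma divisor_fps_nth_0 [simp]: "divisor_fps g $ 0 = 0"
  by (simp add: divisor_fps_def)

lemma divisor_fps_nth: "n > 0 \<Longrightarrow> divisor_fps g $ n = (\<Sum>d | d dvd n. g d)"
  by (simp add: divisor_fps_def)

text \<open>Coefficient i is a sum over the factorisations i = a x with positive factors; i = 0 has
  none, matching the zero constant term. A convolution thus becomes a sum over
  \<open>quads n\<close>, the kind that Liouville's identity evaluates.\<close>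

lemma divisor_fps_mult_nth:
  "(divisor_fps g * divisor_fps h) $ n = (\<Sum>(a, b, x, y) \<in> quads n. g a * h b)"
proof -
  define P where "P i = {(a, x). 0 < a \<and> 0 < x \<and> a * x = i}" for i :: nat
  have fin: "finite (P i)" for i
  proof (rule finite_subset)
    show "P i \<subseteq> {..i} \<times> {..i}" by (auto simp: P_def)
  qed simp
  have nth: "divisor_fps g $ i = (\<Sum>(a, x) \<in> P i. g a)" for g i
  proof (cases "i = 0")
    case True
    then have "P i = {}" by (auto simp: P_def)
    with True show ?thesis by simp
  next
    case False
    then have "(\<Sum>d | d dvd i. g d) = (\<Sum>(a, x) \<in> P i. g a)"
      by (intro sum.reindex_bij_witness[where i = fst and j = "\<lambda>d. (d, i div d)"])
         (auto simp: P_def)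
    with False show ?thesis by (simp add: divisor_fps_nth)
  qed
  have "(divisor_fps g * divisor_fps h) $ n
      = (\<Sum>i\<le>n. \<Sum>(u, v) \<in> P i \<times> P (n - i). g (fst u) * h (fst v))"
    unfolding fps_mult_nth nth atLeast0AtMost
    by (simp add: sum_product sum.cartesian_product case_prod_unfold)
  also have "\<dots> = (\<Sum>(i, u, v) \<in> (SIGMA i:{..n}. P i \<times> P (n - i)). g (fst u) * h (fst v))"
    by (subst sum.Sigma) (auto simp: fin)
  also have "\<dots> = (\<Sum>(a, b, x, y) \<in> quads n. g a * h b)"
    by (rule sum.reindex_bij_witness[where
          i = "\<lambda>(a, b, x, y). (a * x, (a, x), (b, y))" and j = "\<lambda>(i, (a, x), (b, y)). (a, b, x, y)"])
       (auto simp: quads_def P_def)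
  finally show ?thesis .
qed

definition power_fps :: "nat \<Rightarrow> real fps" where
  "power_fps k = divisor_fps (\<lambda>d. real d ^ k)"

text \<open>For d > 0 the exponent d + 1 gives the same sign as d - 1 and avoids truncated
  subtraction.\<close>

definition alt_fps :: "nat \<Rightarrow> real fps" where
  "alt_fps k = divisor_fps (\<lambda>d. (-1) ^ (d + 1) * real d ^ k)"

definition euler_op :: "real fps \<Rightarrow> real fps" where
  "euler_op F = fps_X * fps_deriv F"

lemma euler_op_nth: "euler_op F $ n = real n * F $ n"
  by (cases n) (simp_all add: euler_op_def)

section \<open>Product relations from signed squares and fourth powers\<close>

lemma sum_squares: "(\<Sum>l<d. (real l)\<^sup>2) = (2 * real d ^ 3 - 3 * (real d)\<^sup>2 + real d) / 6"
  by (induction d) (simp_all add: field_simps power2_eq_square power3_eq_cube)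

lemma sum_fourth_powers:
  "(\<Sum>l<d. real l ^ 4) = (6 * real d ^ 5 - 15 * real d ^ 4 + 10 * real d ^ 3 - real d) / 30"
  by (induction d) (simp_all add: field_simps eval_nat_numeral)

lemma sum_alt_squares: "(\<Sum>l<d. (-1) ^ l * (real l)\<^sup>2) = (-1) ^ d * (real d - (real d)\<^sup>2) / 2"
  by (induction d) (simp_all add: field_simps power2_eq_square)

lemma sum_alt_fourth_powers:
  "(\<Sum>l<d. (-1) ^ l * real l ^ 4) = (-1) ^ d * (2 * real d ^ 3 - real d ^ 4 - real d) / 2"
  by (induction d) (simp_all add: field_simps eval_nat_numeral)

text \<open>Liouville's identity for f(x) = x^2, with (a + b)^2 - (a - b)^2 = 4ab. This is
  Ramanujan's differential equation for the Eisenstein series E2 = 1 - 24 e1.\<close>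

lemma power_fps_1_squared:
  "12 * (power_fps 1 * power_fps 1) = 5 * power_fps 3 + power_fps 1 - 6 * euler_op (power_fps 1)"
proof (rule fps_ext)
  fix n
  show "(12 * (power_fps 1 * power_fps 1)) $ n
      = (5 * power_fps 3 + power_fps 1 - 6 * euler_op (power_fps 1)) $ n"
  proof (cases "n = 0")
    case True
    then show ?thesis
      by (simp add: power_fps_def numeral_fps_const euler_op_nth)
  next
    case False
    have "4 * (power_fps 1 * power_fps 1) $ n
        = (\<Sum>(a, b, x, y) \<in> quads n.
            1 ^ (a + b) * ((real a + real b) ^ (1 + 1) - (real a - real b) ^ (1 + 1)))"
      unfolding power_fps_def divisor_fps_mult_nth sum_distrib_left
      by (intro sum.cong refl) (auto simp: algebra_simps eval_nat_numeral power_add)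
    also have "\<dots> = (\<Sum>d | d dvd n. (5 / 3 * real d ^ 3 + 1 / 3 * real d)
            - 2 * (real n * (1 ^ d * real d ^ 1)))"
    proof (rule liouville_power)
      fix d
      show "1 ^ d * (real d + 1) * real d ^ (1 + 1) + 2 * (\<Sum>l<d. 1 ^ l * real l ^ (1 + 1))
          = 5 / 3 * real d ^ 3 + 1 / 3 * real d"
        using sum_squares[of d] by (simp add: field_simps eval_nat_numeral)
    qed (use False in auto)
    finally show ?thesis
      using False
      by (simp add: power_fps_def divisor_fps_nth numeral_fps_const euler_op_nth sum.distrib
            sum_subtractf sum_distrib_left[symmetric] sum_divide_distrib[symmetric] sum_negf)
  qed
qed

text \<open>The same with f(x) = (-1)^x x^2. The signs of the two factors multiply to (-1)^(a+b),
  whereas a single series carries -(-1)^d; hence the reversed signs on the right.\<close>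

lemma alt_fps_1_squared:
  "4 * (alt_fps 1 * alt_fps 1) = 2 * euler_op (alt_fps 1) - alt_fps 3 - alt_fps 1"
proof (rule fps_ext)
  fix n
  show "(4 * (alt_fps 1 * alt_fps 1)) $ n
      = (2 * euler_op (alt_fps 1) - alt_fps 3 - alt_fps 1) $ n"
  proof (cases "n = 0")
    case True
    then show ?thesis
      by (simp add: alt_fps_def numeral_fps_const euler_op_nth)
  next
    case False
    have "4 * (alt_fps 1 * alt_fps 1) $ n
        = (\<Sum>(a, b, x, y) \<in> quads n.
            (- 1) ^ (a + b) * ((real a + real b) ^ (1 + 1) - (real a - real b) ^ (1 + 1)))"
      unfolding alt_fps_def divisor_fps_mult_nth sum_distrib_left
      by (intro sum.cong refl) (auto simp: algebra_simps eval_nat_numeral power_add)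
    also have "\<dots> = (\<Sum>d | d dvd n. ((-1) ^ d * real d ^ 3 + (-1) ^ d * real d)
            - 2 * (real n * ((- 1) ^ d * real d ^ 1)))"
    proof (rule liouville_power)
      fix d
      show "(- 1) ^ d * (real d + 1) * real d ^ (1 + 1) + 2 * (\<Sum>l<d. (- 1) ^ l * real l ^ (1 + 1))
          = (-1) ^ d * real d ^ 3 + (-1) ^ d * real d"
        using sum_alt_squares[of d] by (simp add: field_simps eval_nat_numeral)
    qed (use False in auto)
    finally show ?thesis
      using False
      by (simp add: alt_fps_def divisor_fps_nth numeral_fps_const euler_op_nth sum.distrib
            sum_subtractf sum_distrib_left[symmetric] sum_divide_distrib[symmetric] sum_negf)
  qed
qed

text \<open>From f(x) = x^4; this is Ramanujan's equation for the derivative of E4 = 1 + 240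
  e3.\<close>

lemma power_fps_1_3:
  "240 * (power_fps 1 * power_fps 3)
     = 21 * power_fps 5 + 10 * power_fps 3 - 30 * euler_op (power_fps 3) - power_fps 1"
proof (rule fps_ext)
  fix n
  show "(240 * (power_fps 1 * power_fps 3)) $ n
      = (21 * power_fps 5 + 10 * power_fps 3 - 30 * euler_op (power_fps 3) - power_fps 1) $ n"
  proof (cases "n = 0")
    case True
    then show ?thesis
      by (simp add: power_fps_def numeral_fps_const euler_op_nth)
  next
    case False
    \<comment> \<open>The product is symmetrised because (a + b)^4 - (a - b)^4 = 8 a b^3 + 8 a^3
      b.\<close>
    have "16 * (power_fps 1 * power_fps 3) $ n
        = 8 * (power_fps 1 * power_fps 3) $ n + 8 * (power_fps 3 * power_fps 1) $ n"
      by (simp add: mult.commute[of "power_fps 3"])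
    also have "\<dots>
        = (\<Sum>(a, b, x, y) \<in> quads n.
            1 ^ (a + b) * ((real a + real b) ^ (3 + 1) - (real a - real b) ^ (3 + 1)))"
      unfolding power_fps_def divisor_fps_mult_nth sum_distrib_left sum.distrib[symmetric]
      by (intro sum.cong refl) (auto simp: algebra_simps eval_nat_numeral power_add)
    also have "\<dots> = (\<Sum>d | d dvd n. (7 / 5 * real d ^ 5 + 2 / 3 * real d ^ 3 - 1 / 15 * real d)
            - 2 * (real n * (1 ^ d * real d ^ 3)))"
    proof (rule liouville_power)
      fix d
      show "1 ^ d * (real d + 1) * real d ^ (3 + 1) + 2 * (\<Sum>l<d. 1 ^ l * real l ^ (3 + 1))
          = 7 / 5 * real d ^ 5 + 2 / 3 * real d ^ 3 - 1 / 15 * real d"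
        using sum_fourth_powers[of d] by (simp add: field_simps eval_nat_numeral)
    qed (use False in auto)
    finally show ?thesis
      using False
      by (simp add: power_fps_def divisor_fps_nth numeral_fps_const euler_op_nth sum.distrib
            sum_subtractf sum_distrib_left[symmetric] sum_divide_distrib[symmetric] sum_negf)
  qed
qed

lemma alt_fps_1_3:
  "16 * (alt_fps 1 * alt_fps 3) = 2 * euler_op (alt_fps 3) - alt_fps 5 - 2 * alt_fps 3 + alt_fps 1"
proof (rule fps_ext)
  fix n
  show "(16 * (alt_fps 1 * alt_fps 3)) $ n
      = (2 * euler_op (alt_fps 3) - alt_fps 5 - 2 * alt_fps 3 + alt_fps 1) $ n"
  proof (cases "n = 0")
    case True
    then show ?thesis
      by (simp add: alt_fps_def numeral_fps_const euler_op_nth)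
  next
    case False
    have "16 * (alt_fps 1 * alt_fps 3) $ n
        = 8 * (alt_fps 1 * alt_fps 3) $ n + 8 * (alt_fps 3 * alt_fps 1) $ n"
      by (simp add: mult.commute[of "alt_fps 3"])
    also have "\<dots>
        = (\<Sum>(a, b, x, y) \<in> quads n.
            (- 1) ^ (a + b) * ((real a + real b) ^ (3 + 1) - (real a - real b) ^ (3 + 1)))"
      unfolding alt_fps_def divisor_fps_mult_nth sum_distrib_left sum.distrib[symmetric]
      by (intro sum.cong refl) (auto simp: algebra_simps eval_nat_numeral power_add)
    also have "\<dots> = (\<Sum>d | d dvd n. ((-1) ^ d * real d ^ 5 + 2 * ((-1) ^ d * real d ^ 3) - (-1) ^ d * real d)
            - 2 * (real n * ((- 1) ^ d * real d ^ 3)))"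
    proof (rule liouville_power)
      fix d
      show "(- 1) ^ d * (real d + 1) * real d ^ (3 + 1) + 2 * (\<Sum>l<d. (- 1) ^ l * real l ^ (3 + 1))
          = (-1) ^ d * real d ^ 5 + 2 * ((-1) ^ d * real d ^ 3) - (-1) ^ d * real d"
        using sum_alt_fourth_powers[of d] by (simp add: field_simps eval_nat_numeral)
    qed (use False in auto)
    finally show ?thesis
      using False
      by (simp add: alt_fps_def divisor_fps_nth numeral_fps_const euler_op_nth sum.distrib
            sum_subtractf sum_distrib_left[symmetric] sum_divide_distrib[symmetric] sum_negf)
  qed
qed

section \<open>The operator D, the substitution of X^2, and signed divisor sums\<close>

lemma euler_op_add: "euler_op (F + G) = euler_op F + euler_op G"
  and euler_op_diff: "euler_op (F - G) = euler_op F - euler_op G"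
  and euler_op_mult: "euler_op (F * G) = F * euler_op G + euler_op F * G"
  and euler_op_numeral: "euler_op (numeral m) = 0"
  by (simp_all add: euler_op_def numeral_fps_const algebra_simps)

definition dilate :: "real fps \<Rightarrow> real fps" where
  "dilate F = F oo fps_X\<^sup>2"

lemma dilate_nth: "dilate F $ n = (if even n then F $ (n div 2) else 0)"
proof -
  have "dilate F $ n = (\<Sum>i=0..n. if n = 2 * i then F $ i else 0)"
    unfolding dilate_def fps_compose_nth power_mult[symmetric]
    by (intro sum.cong refl) (simp add: fps_X_power_iff)
  also have "\<dots> = (if even n then F $ (n div 2) else 0)"
  proof (cases "even n")
    case True
    then have "(\<Sum>i=0..n. if n = 2 * i then F $ i else 0) = (\<Sum>i=0..n. if n div 2 = i then F $ i else 0)"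
      by (intro sum.cong refl) auto
    with True show ?thesis by simp
  qed (auto intro!: sum.neutral)
  finally show ?thesis .
qed

lemma dilate_add: "dilate (F + G) = dilate F + dilate G"
  and dilate_diff: "dilate (F - G) = dilate F - dilate G"
  and dilate_mult: "dilate (F * G) = dilate F * dilate G"
  and dilate_numeral: "dilate (numeral m) = numeral m"
  by (simp_all add: dilate_def fps_compose_add_distrib fps_compose_sub_distrib
        fps_compose_mult_distrib numeral_fps_const)

text \<open>Chain rule: the factor 2 is the exponent in X^2.\<close>

lemma dilate_euler_op: "2 * dilate (euler_op F) = euler_op (dilate F)"
  by (rule fps_ext) (auto simp: euler_op_nth dilate_nth numeral_fps_const)

lemma sum_even_divisors:
  fixes g :: "nat \<Rightarrow> real"
  shows "(\<Sum>d | d dvd n \<and> even d. g d) = (if even n then \<Sum>c | c dvd n div 2. g (2 * c) else 0)"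
proof (cases "even n")
  case True
  then have "(\<Sum>d | d dvd n \<and> even d. g d) = (\<Sum>c | c dvd n div 2. g (2 * c))"
    by (intro sum.reindex_bij_witness[where i = "\<lambda>c. 2 * c" and j = "\<lambda>d. d div 2"]) auto
  with True show ?thesis by simp
next
  case False
  then have empty: "{d. d dvd n \<and> even d} = {}"
    using dvd_trans by blast
  show ?thesis
    unfolding empty using False by simp
qed

text \<open>Even divisors d = 2c have the wrong sign, so they are subtracted twice; c runs over the
  divisors of n/2 and contributes 2 (2c)^k = 2^(k+1) c^k.\<close>

lemma alt_fps_conv: "alt_fps k = power_fps k - 2 ^ (k + 1) * dilate (power_fps k)"
proof (rule fps_ext)
  fix n
  show "alt_fps k $ n = (power_fps k - 2 ^ (k + 1) * dilate (power_fps k)) $ n"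
  proof (cases "n = 0")
    case True
    then show ?thesis by (simp add: alt_fps_def power_fps_def dilate_nth numeral_fps_const fps_const_power)
  next
    case False
    then have fin: "finite {d. d dvd n}" by simp
    have "(\<Sum>d | d dvd n. (-1) ^ (d + 1) * real d ^ k)
        = (\<Sum>d | d dvd n. real d ^ k - (if even d then 2 * real d ^ k else 0))"
      by (intro sum.cong refl) (auto simp: minus_one_power_iff)
    also have "\<dots> = (\<Sum>d | d dvd n. real d ^ k) - (\<Sum>d | d dvd n \<and> even d. 2 * real d ^ k)"
      using fin by (simp add: sum_subtractf sum.If_cases Collect_conj_eq)
    finally show ?thesis
      using False
      by (auto simp: alt_fps_def power_fps_def divisor_fps_nth dilate_nth sum_even_divisors
           numeral_fps_const fps_const_power power_mult_distrib sum_distrib_left mult.assoc dvd_div_eq_0_iff)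
  qed
qed

text \<open>The sign at d is negative exactly when n/d is even, that is, when n is even and d
  divides n/2.\<close>

lemma sigma_hat_conv:
  assumes "n > 0"
  shows "sigma_hat n = (power_fps 1 - 2 * dilate (power_fps 1)) $ n"
proof -
  have fin: "finite {d. d dvd n}" using assms by simp
  have "sigma_hat n = (\<Sum>d | d dvd n. real d - (if 2 * d dvd n then 2 * real d else 0))"
    unfolding sigma_hat_def
  proof (intro sum.cong refl)
    fix d assume "d \<in> {d. d dvd n}"
    then obtain c where c: "n = d * c" by auto
    with assms have "d > 0" "c > 0" by auto
    then have eqs: "2 * d dvd n \<longleftrightarrow> even c" "n div d = c"
      by (simp_all add: c mult.commute[of d])
    then show "(-1) ^ (n div d - 1) * real d = real d - (if 2 * d dvd n then 2 * real d else 0)"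
      unfolding eqs using \<open>c > 0\<close> by (cases c) (auto simp: minus_one_power_iff)
  qed
  also have "\<dots> = (\<Sum>d | d dvd n. real d) - (\<Sum>d | d dvd n \<and> 2 * d dvd n. 2 * real d)"
    using fin by (simp add: sum_subtractf sum.If_cases Collect_conj_eq)
  also have "{d. d dvd n \<and> 2 * d dvd n} = (if even n then {d. d dvd n div 2} else {})"
    by (auto dest: dvd_mult_left dvd_mult_right simp: dvd_div_iff_mult mult.commute)
  finally show ?thesis
    using assms
    by (auto simp: power_fps_def divisor_fps_nth dilate_nth numeral_fps_const
         sum_distrib_left dvd_div_eq_0_iff)
qed

lemma sigma_tilde_conv:
  assumes "n > 0"
  shows "sigma_tilde k n = alt_fps k $ n"
proof -
  have "sigma_tilde k n = (\<Sum>d | d dvd n. (-1) ^ (d + 1) * real d ^ k)"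
    unfolding sigma_tilde_def
  proof (intro sum.cong refl)
    fix d assume "d \<in> {d. d dvd n}"
    with assms have "d > 0" by (auto intro: Nat.gr0I)
    then show "(-1) ^ (d - 1) * real d ^ k = (-1) ^ (d + 1) * real d ^ k"
      by (cases d) auto
  qed
  with assms show ?thesis by (simp add: alt_fps_def divisor_fps_nth)
qed

section \<open>Elimination: the identities for u^2 and u^3\<close>

lemma dilate_power_fps_1: "4 * dilate (power_fps 1) = power_fps 1 - alt_fps 1"
  and dilate_power_fps_3: "16 * dilate (power_fps 3) = power_fps 3 - alt_fps 3"
  and dilate_power_fps_5: "64 * dilate (power_fps 5) = power_fps 5 - alt_fps 5"
  by (simp_all add: alt_fps_conv)

text \<open>Substitute X^2 in \<open>power_fps_1_squared\<close> and multiply by 16 = 4 * 4, which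
  turns each dilated series into a difference.\<close>

lemma diff_1_squared:
  "12 * ((power_fps 1 - alt_fps 1) * (power_fps 1 - alt_fps 1)) = 5 * (power_fps 3 - alt_fps 3)
     + 4 * (power_fps 1 - alt_fps 1) - 12 * euler_op (power_fps 1 - alt_fps 1)"
proof -
  have "12 * (dilate (power_fps 1) * dilate (power_fps 1))
      = 5 * dilate (power_fps 3) + dilate (power_fps 1) - 6 * dilate (euler_op (power_fps 1))"
    using arg_cong[OF power_fps_1_squared, of dilate]
    by (simp add: dilate_add dilate_diff dilate_mult dilate_numeral)
  moreover have "euler_op (power_fps 1 - alt_fps 1) = 4 * (2 * dilate (euler_op (power_fps 1)))"
    unfolding dilate_euler_op dilate_power_fps_1[symmetric] euler_op_mult euler_op_numeral by simp
  ultimately show ?thesis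
    using dilate_power_fps_1 dilate_power_fps_3 by algebra
qed

text \<open>The same for \<open>power_fps_1_3\<close>, multiplied by 64 = 4 * 16.\<close>

lemma diff_1_3:
  "240 * ((power_fps 1 - alt_fps 1) * (power_fps 3 - alt_fps 3))
     = 21 * (power_fps 5 - alt_fps 5)
     + 40 * (power_fps 3 - alt_fps 3) - 60 * euler_op (power_fps 3 - alt_fps 3)
     - 16 * (power_fps 1 - alt_fps 1)"
proof -
  have "240 * (dilate (power_fps 1) * dilate (power_fps 3))
      = 21 * dilate (power_fps 5) + 10 * dilate (power_fps 3) - 30 * dilate (euler_op (power_fps 3))
        - dilate (power_fps 1)"
    using arg_cong[OF power_fps_1_3, of dilate]
    by (simp add: dilate_add dilate_diff dilate_mult dilate_numeral)
  moreover have "euler_op (power_fps 3 - alt_fps 3) = 16 * (2 * dilate (euler_op (power_fps 3)))"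
    unfolding dilate_euler_op dilate_power_fps_3[symmetric] euler_op_mult euler_op_numeral by simp
  ultimately show ?thesis
    using dilate_power_fps_1 dilate_power_fps_3 dilate_power_fps_5 by algebra
qed

text \<open>By (e1 + t1)^2 = 2 e1^2 + 2 t1^2 - (e1 - t1)^2; in this combination all terms with D
  cancel.\<close>

lemma square_identity:
  "12 * ((power_fps 1 + alt_fps 1) * (power_fps 1 + alt_fps 1)) + 2 * (power_fps 1 + alt_fps 1)
     = 5 * power_fps 3 - alt_fps 3"
  using power_fps_1_squared alt_fps_1_squared diff_1_squared
  unfolding euler_op_diff by algebra

text \<open>Multiplying the square identity by u calls for the mixed products e1 t3 and t1 e3 with
  different weights, but \<open>diff_1_3\<close> controls only their sum. Differentiating the square
  identity yields a second relation between them.\<close>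

lemma cube_identity:
  fixes u defines "u \<equiv> power_fps 1 + alt_fps 1"
  shows "192 * (u * u * u) + 48 * (u * u) + 4 * u = 7 * power_fps 5 + alt_fps 5"
proof -
  have sq: "12 * (u * u) + 2 * u = 5 * power_fps 3 - alt_fps 3"
    unfolding u_def by (rule square_identity)
  \<comment> \<open>The squares enter as e1^2 - t1^2 = u (e1 - t1), so multiplying by u produces
    u^2, which \<open>sq\<close> makes linear.\<close>
  have euler_u: "6 * euler_op u = 5 * power_fps 3 + 3 * alt_fps 3 + power_fps 1 + 3 * alt_fps 1
      - 12 * u * (power_fps 1 - alt_fps 1)"
    using power_fps_1_squared alt_fps_1_squared unfolding u_def euler_op_add by algebra
  have "24 * u * euler_op u + 2 * euler_op u = 5 * euler_op (power_fps 3) - euler_op (alt_fps 3)"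
    using arg_cong[OF sq, of euler_op]
    by (simp add: euler_op_add euler_op_diff euler_op_mult euler_op_numeral algebra_simps)
  then have "6 * (5 * euler_op (power_fps 3) - euler_op (alt_fps 3))
      = 96 * (power_fps 1 * alt_fps 3) + 240 * (alt_fps 1 * power_fps 3) + 48 * (alt_fps 1 * alt_fps 3)
        + 24 * u * (3 * power_fps 1 + alt_fps 1) + 12 * euler_op u"
    using sq euler_u u_def by algebra
  \<comment> \<open>The factor 3 makes the coefficients integral. One suitable combination is twice
    the preceding relation plus \<open>diff_1_3\<close> minus 24 times \<open>alt_fps_1_3\<close>;
    the D terms of e3 and t3 cancel in it.\<close>
  then have "3 * (192 * (u * u * u) + 48 * (u * u) + 4 * u) = 3 * (7 * power_fps 5 + alt_fps 5)"
    using sq euler_u u_def power_fps_1_3 alt_fps_1_3 diff_1_3[unfolded euler_op_diff] by algebra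
  then show ?thesis
    by (simp only: mult_cancel_left) simp
qed

section \<open>Comparison of coefficients, including the values at 0\<close>

theorem theorem3p3:
  fixes n :: nat
  shows "5 * sigma3 n - sigma_tilde3 n
           = 48 * (\<Sum>(i, j) \<in> {(i, j). i + j = n}. sigma_hat0 i * sigma_hat0 j)
       \<and> 7 * sigma5 n + sigma_tilde5 n
           = 1536 * (\<Sum>(i, j, k) \<in> {(i, j, k). i + j + k = n}.
                        sigma_hat0 i * sigma_hat0 j * sigma_hat0 k)"
proof -
  define P where "P = Abs_fps sigma_hat0"
  define u where "u = power_fps 1 + alt_fps 1"
  have P_nth: "P $ i = sigma_hat0 i" for i
    by (simp add: P_def)
  have power_nth: "power_fps k $ i = (if i = 0 then 0 else sigma k i)" for k i
    by (simp add: power_fps_def divisor_fps_nth sigma_def)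
  have alt_nth: "alt_fps k $ i = (if i = 0 then 0 else sigma_tilde k i)" for k i
    by (simp add: sigma_tilde_conv) (simp add: alt_fps_def)
  \<comment> \<open>The 1 is 24 times the value 1/24 at 0; the term 4
    \<open>dilate (power_fps 1)\<close> equals e1 - t1, which leaves u in the bracket.\<close>
  have "24 * P = 1 + 12 * (2 * power_fps 1 - 4 * dilate (power_fps 1))"
    by (rule fps_ext)
       (auto simp: P_nth sigma_hat0_def sigma_hat_conv numeral_fps_const power_nth dilate_nth)
  then have P: "24 * P = 1 + 12 * u"
    unfolding dilate_power_fps_1 by (simp add: u_def)
  \<comment> \<open>Here 12 * 48 = 24^2 and (1 + 12u)^2 = 1 + 12 (12u^2 + 2u). At n = 0 the extra 1
    is accounted for by 12 (5/240 + 1/16) = 1.\<close>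
  have "12 * (48 * (P * P)) = 12 * (5 * power_fps 3 - alt_fps 3) + 1"
    using square_identity P unfolding u_def[symmetric] by algebra
  then have "(12 * (48 * (P * P))) $ n = (12 * (5 * power_fps 3 - alt_fps 3) + 1) $ n"
    by simp
  then have sq: "5 * sigma3 n - sigma_tilde3 n = 48 * (P * P) $ n"
    by (auto simp: numeral_fps_const power_nth alt_nth sigma3_def sigma_tilde3_def split: if_splits)
  \<comment> \<open>Likewise 9 * 1536 = 24^3 and (1 + 12u)^3 = 1 + 9 (192u^3 + 48u^2 + 4u), with 9
    (-7/504 + 1/8) = 1 at n = 0.\<close>
  have "9 * (1536 * (P * (P * P))) = 9 * (7 * power_fps 5 + alt_fps 5) + 1"
    using cube_identity P unfolding u_def[symmetric] by algebra
  then have "(9 * (1536 * (P * (P * P)))) $ n = (9 * (7 * power_fps 5 + alt_fps 5) + 1) $ n"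
    by simp
  then have cube: "7 * sigma5 n + sigma_tilde5 n = 1536 * (P * (P * P)) $ n"
    by (auto simp: numeral_fps_const power_nth alt_nth sigma5_def sigma_tilde5_def split: if_splits)
  have pairs: "(P * P) $ m = (\<Sum>(i, j) \<in> {(i, j). i + j = m}. sigma_hat0 i * sigma_hat0 j)" for m
    unfolding fps_mult_nth P_nth
    by (rule sum.reindex_bij_witness[where i = fst and j = "\<lambda>i. (i, m - i)"]) auto
  have fin: "finite {(i, j). i + j = m}" for m :: nat
    by (rule finite_subset[of _ "{..m} \<times> {..m}"]) auto
  have "(P * (P * P)) $ n
      = (\<Sum>i=0..n. \<Sum>(j, k) \<in> {(j, k). j + k = n - i}. sigma_hat0 i * sigma_hat0 j * sigma_hat0 k)"
    unfolding fps_mult_nth[of P "P * P"] pairs P_nth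
    by (simp add: sum_distrib_left case_prod_unfold mult.assoc)
  also have "\<dots> = (\<Sum>(i, j, k) \<in> (SIGMA i:{0..n}. {(j, k). j + k = n - i}).
      sigma_hat0 i * sigma_hat0 j * sigma_hat0 k)"
    by (subst sum.Sigma) (auto simp: fin)
  also have "(SIGMA i:{0..n}. {(j, k). j + k = n - i}) = {(i, j, k). i + j + k = n}"
    by auto
  finally have triples: "(P * (P * P)) $ n = (\<Sum>(i, j, k) \<in> {(i, j, k). i + j + k = n}.
      sigma_hat0 i * sigma_hat0 j * sigma_hat0 k)" .
  show ?thesis
    using sq cube pairs triples by simp
qed

end
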